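(* Let $h$ be a real, symmetric $M\times M$ matrix (one-particle Hamiltonian) whose graph $G(h)$ is connected and which satisfies $h_{ij}\le0$ for all $i\ne j$. Then the ground state $\phi_0\in\mathbb{C}^M$ of $h$ is non-degenerate and can be chosen strictly positive on every vertex, i.e. $\phi_{0,i}>0$ for all $i\in X=\{1,\dots,M\}$. Moreover, for any $1\le N\le M$ and any (pure or ensemble) ground-state density $\rho$ of $N$ non-interacting fermions on $G(h)$, i.e. of the Hamiltonian $H=\sum_{i,j}h_{ij}\hat a_i^\dagger\hat a_j$ on $\mathcal{H}_N=\Lambda^N\mathbb{C}^M$, one has $\rho_i>0$ for all $i\in X$.
   Context: The graph $G(h)$ of a Hermitian $M\times M$ matrix $h$ has vertex set $X=\{1,\dots,M\}$ and $i\sim j$ iff $i\neq j$ and $h_{ij}\ne0$. $\mathcal{H}_N=\Lambda^N\mathbb{C}^M$ is the $N$-fold antisymmetric tensor product with orthonormal basis $e_I=e_{i_1}\wedge\dots\wedge e_{i_N}$, $I=(i_1<\dots<i_N)$, and $\hat a_i^\dagger,\hat a_i$ are the fermionic creation/annihilation operators for the standard basis vector $e_i$. The density of a normalized state $\Psi$ is $\rho_i=\langle\Psi,\hat a_i^\dagger\hat a_i\Psi\rangle$, and of a density matrix $\Gamma$ (positive semidefinite, trace one) it is $\rho_i=\mathrm{Tr}(\Gamma\hat a_i^\dagger\hat a_i)$. A ground-state density is the density of a normalized eigenvector for the smallest eigenvalue of $H$, or of a density matrix $\Gamma$ with $\mathrm{Tr}(\Gamma H)$ equal to that smallest eigenvalue.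 *)

theory Defs
  imports "HOL-Analysis.Analysis"
begin

text \<open>
  The vertex set \<open>{1,\<dots>,M}\<close> is a type \<open>'m\<close> that is finite and linearly ordered, with
  \<open>M = CARD('m)\<close>; the order only fixes the sign convention for the basis vectors
  \<open>e\<^sub>I\<close> of the exterior powers.
\<close>

definition hermitian :: "complex^'n^'n \<Rightarrow> bool" where
  "hermitian A \<longleftrightarrow> (\<forall>i j. A $ i $ j = cnj (A $ j $ i))"

definition adjoint_mat :: "complex^'n^'k \<Rightarrow> complex^'k^'n" where
  "adjoint_mat A = (\<chi> i j. cnj (A $ j $ i))"

definition cinner :: "complex^'n \<Rightarrow> complex^'n \<Rightarrow> complex" where
  "cinner x y = (\<Sum>i\<in>UNIV. cnj (x $ i) * y $ i)"

definition graph_edges :: "complex^'m^'m \<Rightarrow> ('m \<times> 'm) set" where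
  "graph_edges h = {(i, j). i \<noteq> j \<and> h $ i $ j \<noteq> 0}"

text \<open>For Hermitian \<open>h\<close> the edge relation is symmetric, so directed paths are paths of the graph.\<close>

definition graph_connected :: "complex^'m^'m \<Rightarrow> bool" where
  "graph_connected h \<longleftrightarrow> (\<forall>i j. (i, j) \<in> (graph_edges h)\<^sup>*)"

abbreviation complexify :: "real^'n^'k \<Rightarrow> complex^'n^'k" where
  "complexify A \<equiv> map_matrix complex_of_real A"

text \<open>
  Eigenvalues of \<open>A\<close> restricted to a subspace \<open>V\<close>. These are used only for Hermitian \<open>A\<close> leaving \<open>V\<close>
  invariant, so real eigenvalues are the only ones.
\<close>

definition eigenspace_on :: "(complex^'n) set \<Rightarrow> complex^'n^'n \<Rightarrow> real \<Rightarrow> (complex^'n) set" where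
  "eigenspace_on V A E = {v \<in> V. A *v v = complex_of_real E *s v}"

definition eigenvalue_on :: "(complex^'n) set \<Rightarrow> complex^'n^'n \<Rightarrow> real \<Rightarrow> bool" where
  "eigenvalue_on V A E \<longleftrightarrow> (\<exists>v \<in> eigenspace_on V A E. v \<noteq> 0)"

definition ground_energy_on :: "(complex^'n) set \<Rightarrow> complex^'n^'n \<Rightarrow> real \<Rightarrow> bool" where
  "ground_energy_on V A E \<longleftrightarrow>
     eigenvalue_on V A E \<and> (\<forall>E'. eigenvalue_on V A E' \<longrightarrow> E \<le> E')"

definition ground_state_on :: "(complex^'n) set \<Rightarrow> complex^'n^'n \<Rightarrow> complex^'n \<Rightarrow> bool" where
  "ground_state_on V A \<psi> \<longleftrightarrow>
     (\<exists>E. ground_energy_on V A E \<and> \<psi> \<in> eigenspace_on V A E \<and> norm \<psi> = 1)"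

text \<open>
  The full Fock space, the direct sum of all exterior powers of \<open>\<complex>\<^sup>M\<close>, is \<open>complex^('m set)\<close>:
  the component at \<open>I\<close> is the coefficient of \<open>e\<^sub>I\<close>, with \<open>I\<close> listed increasingly.
  The \<open>N\<close>-th exterior power is the span of the \<open>e\<^sub>I\<close> with \<open>card I = N\<close>.
\<close>

definition sector :: "nat \<Rightarrow> (complex^(('m::finite) set)) set" where
  "sector N = {\<Psi>. \<forall>I. card I \<noteq> N \<longrightarrow> \<Psi> $ I = 0}"

text \<open>
  The matrix of \<open>\<Psi> \<mapsto> e\<^sub>i \<and> \<Psi>\<close>; the sign comes from moving \<open>e\<^sub>i\<close> past the
  factors \<open>e\<^sub>j\<close> with \<open>j < i\<close>.
\<close>

definition creation :: "'m::{finite,linorder} \<Rightarrow> complex^('m set)^('m set)" where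
  "creation i =
     (\<chi> I J. if i \<notin> J \<and> I = insert i J then (- 1) ^ card {j \<in> J. j < i} else 0)"

lemma creation_axis:
  "creation i *v axis J 1 =
     (if i \<in> J then 0 else (- 1) ^ card {j \<in> J. j < i} *s axis (insert i J) 1)"
  by (auto simp: vec_eq_iff matrix_vector_mult_def creation_def axis_def mult_delta_right)

definition annihilation :: "'m::{finite,linorder} \<Rightarrow> complex^('m set)^('m set)" where
  "annihilation i = adjoint_mat (creation i)"

definition number_op :: "'m::{finite,linorder} \<Rightarrow> complex^('m set)^('m set)" where
  "number_op i = creation i ** annihilation i"

definition hamiltonian ::
    "complex^('m::{finite,linorder})^('m::{finite,linorder}) \<Rightarrow> complex^('m set)^('m set)" where
  "hamiltonian h =
     (\<chi> I J. \<Sum>i\<in>UNIV. \<Sum>j\<in>UNIV. h $ i $ j * (creation i ** annihilation j) $ I $ J)"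

text \<open>Operators on the \<open>N\<close>-particle space are extended by zero to the Fock space.\<close>

definition density_matrix :: "nat \<Rightarrow> complex^(('m::finite) set)^('m set) \<Rightarrow> bool" where
  "density_matrix N \<Gamma> \<longleftrightarrow>
     (\<forall>I J. card I \<noteq> N \<or> card J \<noteq> N \<longrightarrow> \<Gamma> $ I $ J = 0) \<and>
     hermitian \<Gamma> \<and> (\<forall>\<Psi>. 0 \<le> Re (cinner \<Psi> (\<Gamma> *v \<Psi>))) \<and> trace \<Gamma> = 1"

definition pure_ground_state_density ::
    "complex^('m::{finite,linorder})^('m::{finite,linorder}) \<Rightarrow> nat
      \<Rightarrow> real^('m::{finite,linorder}) \<Rightarrow> bool" where
  "pure_ground_state_density h N \<rho> \<longleftrightarrow>
     (\<exists>\<Psi>. ground_state_on (sector N) (hamiltonian h) \<Psi> \<and>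
          (\<forall>i. complex_of_real (\<rho> $ i) = cinner \<Psi> (number_op i *v \<Psi>)))"

definition ensemble_ground_state_density ::
    "complex^('m::{finite,linorder})^('m::{finite,linorder}) \<Rightarrow> nat
      \<Rightarrow> real^('m::{finite,linorder}) \<Rightarrow> bool" where
  "ensemble_ground_state_density h N \<rho> \<longleftrightarrow>
     (\<exists>\<Gamma> E. density_matrix N \<Gamma> \<and> ground_energy_on (sector N) (hamiltonian h) E \<and>
          trace (\<Gamma> ** hamiltonian h) = complex_of_real E \<and>
          (\<forall>i. complex_of_real (\<rho> $ i) = trace (\<Gamma> ** number_op i)))"

end

theory Submission
  imports Defs
begin

text \<open>
  Since \<open>h\<close> has nonpositive off-diagonal entries, replacing a lowest eigenvector by its absolute
  value does not raise the energy; connectedness then makes every lowest eigenvector nowhere zero,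
  which gives a simple lowest eigenvalue with a positive eigenvector \<open>\<phi>\<close>.
  Although the \<open>N\<close>-particle ground state may be degenerate, every ground state \<open>\<Psi>\<close> has the mode \<open>\<phi>\<close>
  occupied, that is \<open>a\<^sup>\<dagger>(\<phi>) \<Psi> = 0\<close>. If moreover \<open>a\<^sub>i \<Psi> = 0\<close> for some vertex \<open>i\<close>, the anticommutation
  relation gives \<open>\<phi>\<^sub>i \<Psi> = a\<^sub>i a\<^sup>\<dagger>(\<phi>) \<Psi> + a\<^sup>\<dagger>(\<phi>) a\<^sub>i \<Psi> = 0\<close>, contradicting \<open>\<phi>\<^sub>i > 0\<close>; so
  \<open>\<rho>\<^sub>i = \<parallel>a\<^sub>i \<Psi>\<parallel>\<^sup>2 > 0\<close>. An ensemble is a sum of rank-one terms, each of which minimises the energy.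
\<close>

subsection \<open>Rayleigh quotients of self-adjoint maps\<close>

text \<open>If the residual \<open>w = f v - e v\<close> were nonzero, a short step from
  \<open>v\<close> against \<open>w\<close> would push the form \<open>q\<close> below zero. The
  subspace \<open>S\<close> allows an application to a single particle-number sector.\<close>

lemma rayleigh_minimiser_eigenvector:
  fixes f :: "'a::real_inner \<Rightarrow> 'a"
  assumes lin: "linear f" and sa: "\<And>x y. f x \<bullet> y = x \<bullet> f y"
    and S: "subspace S" and inv: "\<And>x. x \<in> S \<Longrightarrow> f x \<in> S"
    and ge: "\<And>x. x \<in> S \<Longrightarrow> e * (x \<bullet> x) \<le> x \<bullet> f x"
    and v: "v \<in> S" and eq: "v \<bullet> f v \<le> e * (v \<bullet> v)"
  shows "f v = e *\<^sub>R v"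
proof (rule ccontr)
  define w where "w = f v - e *\<^sub>R v"
  define q where "q x = x \<bullet> f x - e * (x \<bullet> x)" for x
  assume "f v \<noteq> e *\<^sub>R v"
  then have ww: "0 < w \<bullet> w" by (simp add: w_def)
  have w: "w \<in> S" unfolding w_def by (intro subspace_diff subspace_scale S inv v)
  have expand: "q (v - t *\<^sub>R w) = q v - 2 * t * (w \<bullet> w) + t\<^sup>2 * q w" for t
  proof -
    have "w \<bullet> f v - e * (w \<bullet> v) = w \<bullet> (f v - e *\<^sub>R v)"
      "v \<bullet> f w - e * (v \<bullet> w) = (f v - e *\<^sub>R v) \<bullet> w"
      by (simp_all add: inner_diff_left inner_diff_right sa)
    then have "w \<bullet> f v - e * (w \<bullet> v) = w \<bullet> w" "v \<bullet> f w - e * (v \<bullet> w) = w \<bullet> w"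
      by (simp_all flip: w_def)
    then have "t * (w \<bullet> f v - e * (w \<bullet> v)) = t * (w \<bullet> w)"
      "t * (v \<bullet> f w - e * (v \<bullet> w)) = t * (w \<bullet> w)" by simp_all
    then show ?thesis
      unfolding q_def
      by (simp add: linear_diff[OF lin] linear_scale[OF lin] algebra_simps power2_eq_square)
  qed
  have qw: "0 \<le> q w" using ge[OF w] by (simp add: q_def)
  \<comment> \<open>With this step the second-order gain is at most half of the first-order loss;
    the \<open>+ 1\<close> covers \<open>q w = 0\<close>.\<close>
  define t where "t = (w \<bullet> w) / (q w + 1)"
  have t: "0 < t" using ww qw by (simp add: t_def)
  have "t * q w \<le> t * (q w + 1)" using t by simp
  also have "\<dots> = w \<bullet> w" using qw by (simp add: t_def)
  finally have "t * (t * q w) \<le> t * (w \<bullet> w)" using t by simp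
  moreover have "0 \<le> q (v - t *\<^sub>R w)"
    using ge[of "v - t *\<^sub>R w"] w v S by (simp add: q_def subspace_diff subspace_scale)
  moreover have "q v \<le> 0" using eq by (simp add: q_def)
  ultimately have "t * (w \<bullet> w) \<le> 0" unfolding expand by (simp add: power2_eq_square)
  then show False using t ww by (simp add: mult_le_0_iff)
qed

text \<open>The quadratic form attains its minimum on the compact unit sphere of \<open>S\<close>;
  the bound extends to \<open>S\<close> by homogeneity, and the minimiser is an eigenvector.\<close>

lemma selfadjoint_least_eigenvalue:
  fixes f :: "'a::euclidean_space \<Rightarrow> 'a"
  assumes lin: "linear f" and sa: "\<And>x y. f x \<bullet> y = x \<bullet> f y"
    and S: "subspace S" and inv: "\<And>x. x \<in> S \<Longrightarrow> f x \<in> S"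
    and x0: "x0 \<in> S" "x0 \<noteq> 0"
  obtains v e where "v \<in> S" "norm v = 1" "f v = e *\<^sub>R v"
    "\<And>x. x \<in> S \<Longrightarrow> e * (x \<bullet> x) \<le> x \<bullet> f x"
proof -
  let ?K = "S \<inter> sphere 0 1"
  have "compact ?K"
    using S by (simp add: closed_Int_compact closed_subspace)
  moreover have "x0 /\<^sub>R norm x0 \<in> ?K"
    using x0 S by (simp add: subspace_scale)
  moreover have "continuous_on ?K (\<lambda>x. x \<bullet> f x)"
    using lin by (intro continuous_intros linear_continuous_on) (simp add: linear_conv_bounded_linear)
  ultimately obtain v where v: "v \<in> ?K" and min: "\<And>y. y \<in> ?K \<Longrightarrow> v \<bullet> f v \<le> y \<bullet> f y"
    using continuous_attains_inf[of ?K "\<lambda>x. x \<bullet> f x"] by blast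
  define e where "e = v \<bullet> f v"
  have ge: "e * (x \<bullet> x) \<le> x \<bullet> f x" if "x \<in> S" for x
  proof (cases "x = 0")
    case False
    have "x /\<^sub>R norm x \<in> ?K" using that S False by (simp add: subspace_scale)
    from min[OF this] have "e \<le> (x \<bullet> f x) / (norm x)\<^sup>2"
      by (simp add: e_def linear_scale[OF lin] power2_eq_square divide_inverse mult_ac)
    then show ?thesis using False
      by (simp add: pos_le_divide_eq power2_norm_eq_inner)
  qed simp
  have "v \<bullet> v = 1" using v by (simp add: norm_eq_sqrt_inner)
  then have "f v = e *\<^sub>R v"
    using v by (intro rayleigh_minimiser_eigenvector[OF lin sa S inv ge]) (auto simp: e_def)
  then show ?thesis using that[of v e] v ge by auto
qed

subsection \<open>The one-particle ground state\<close>

lemma symmetric_inner_mult: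
  fixes h :: "real^'n^'n"
  assumes "transpose h = h"
  shows "(h *v x) \<bullet> y = x \<bullet> (h *v y)"
  using dot_lmul_matrix[of x h y] transpose_matrix_vector[of h x] assms by simp

lemma transpose_eq_self_nth:
  "transpose h = h \<Longrightarrow> h $ i $ j = h $ j $ i"
  by (metis transpose_def vec_lambda_beta)

text \<open>The absolute value of a lowest eigenvector has no larger energy, so it is again a lowest
  eigenvector; at a vertex where it vanishes, the eigenvalue equation is a vanishing sum of
  nonpositive terms, and the zero spreads to all neighbours.\<close>

lemma lowest_eigenvector_nonzero:
  fixes h :: "real^'m^'m"
  assumes sym: "transpose h = h" and con: "graph_connected (complexify h)"
    and neg: "\<And>i j. i \<noteq> j \<Longrightarrow> h $ i $ j \<le> 0"
    and ge: "\<And>x. e * (x \<bullet> x) \<le> x \<bullet> (h *v x)"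
    and u: "h *v u = e *\<^sub>R u" "u \<noteq> 0"
  shows "h *v (\<chi> i. \<bar>u $ i\<bar>) = e *\<^sub>R (\<chi> i. \<bar>u $ i\<bar>)" "u $ i \<noteq> 0"
proof -
  define w :: "real^'m" where "w = (\<chi> i. \<bar>u $ i\<bar>)"
  have ww: "w \<bullet> w = u \<bullet> u" by (simp add: w_def inner_vec_def)
  have quad: "x \<bullet> (h *v x) = (\<Sum>i\<in>UNIV. \<Sum>j\<in>UNIV. h $ i $ j * (x $ i * x $ j))" for x :: "real^'m"
    by (simp add: inner_vec_def matrix_vector_mult_def sum_distrib_left mult_ac)
  \<comment> \<open>Diagonal terms agree, and off the diagonal a nonpositive factor reverses
    \<open>x \<le> \<bar>x\<bar>\<close>.\<close>
  have "h $ i $ j * (w $ i * w $ j) \<le> h $ i $ j * (u $ i * u $ j)" for i j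
  proof (cases "i = j")
    case False
    then show ?thesis
      by (simp add: w_def neg mult_left_mono_neg flip: abs_mult)
  qed (simp add: w_def)
  then have "w \<bullet> (h *v w) \<le> u \<bullet> (h *v u)"
    unfolding quad by (intro sum_mono)
  also have "\<dots> = e * (w \<bullet> w)" by (simp add: u ww)
  finally have w: "h *v w = e *\<^sub>R w"
    by (intro rayleigh_minimiser_eigenvector[of "(*v) h" UNIV])
      (auto simp: symmetric_inner_mult[OF sym] ge)
  then show "h *v (\<chi> i. \<bar>u $ i\<bar>) = e *\<^sub>R (\<chi> i. \<bar>u $ i\<bar>)" by (simp add: w_def)
  have step: "u $ j = 0" if "u $ i = 0" "(i, j) \<in> graph_edges (complexify h)" for i j
  proof -
    have "(\<Sum>k\<in>UNIV. h $ i $ k * w $ k) = 0"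
      using arg_cong[OF w, of "\<lambda>x. x $ i"] that(1) by (simp add: matrix_vector_mult_def w_def)
    then have "(\<Sum>k\<in>UNIV. - (h $ i $ k * w $ k)) = 0" by (simp add: sum_negf)
    \<comment> \<open>The sign of \<open>h $ i $ i\<close> is unknown, but its term vanishes because
      \<open>w $ i = 0\<close>.\<close>
    moreover have "0 \<le> - (h $ i $ k * w $ k)" for k
      using neg[of i k] that(1) by (cases "i = k") (auto simp: w_def mult_le_0_iff)
    ultimately have "h $ i $ j * w $ j = 0"
      by (subst (asm) sum_nonneg_eq_0_iff) auto
    then show ?thesis using that(2) by (auto simp: graph_edges_def w_def map_matrix_def)
  qed
  show "u $ i \<noteq> 0"
  proof
    assume i: "u $ i = 0"
    have "u $ j = 0" for j
    proof -
      have "(i, j) \<in> (graph_edges (complexify h))\<^sup>*"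
        using con by (simp add: graph_connected_def)
      then show ?thesis by induction (use i step in auto)
    qed
    then show False using u(2) by (simp add: vec_eq_iff)
  qed
qed

text \<open>Simplicity: subtracting a multiple of \<open>\<phi>\<close> makes a lowest eigenvector
  vanish at one vertex, and a lowest eigenvector with a zero is zero.\<close>

lemma lowest_eigenspace:
  fixes h :: "real^'m^'m"
  assumes sym: "transpose h = h" and con: "graph_connected (complexify h)"
    and neg: "\<And>i j. i \<noteq> j \<Longrightarrow> h $ i $ j \<le> 0"
  obtains \<phi> e where "norm \<phi> = 1" "h *v \<phi> = e *\<^sub>R \<phi>" "\<And>i. 0 < \<phi> $ i"
    "\<And>x. e * (x \<bullet> x) \<le> x \<bullet> (h *v x)"
    "\<And>u. h *v u = e *\<^sub>R u \<Longrightarrow> \<exists>c. u = c *\<^sub>R \<phi>"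
proof -
  obtain u e where u: "norm u = 1" "h *v u = e *\<^sub>R u"
    and ge: "\<And>x. e * (x \<bullet> x) \<le> x \<bullet> (h *v x)"
    using selfadjoint_least_eigenvalue[of "(*v) h" UNIV 1]
    by (auto simp: symmetric_inner_mult[OF sym])
  have nz: "h *v (\<chi> i. \<bar>x $ i\<bar>) = e *\<^sub>R (\<chi> i. \<bar>x $ i\<bar>)" "x $ i \<noteq> 0"
    if "h *v x = e *\<^sub>R x" "x \<noteq> 0" for x i
    by (rule lowest_eigenvector_nonzero[of h e]; use sym con neg ge that in blast)+
  define \<phi> :: "real^'m" where "\<phi> = (\<chi> i. \<bar>u $ i\<bar>)"
  have "u \<noteq> 0" using u(1) by auto
  then have pos: "0 < \<phi> $ i" and eig: "h *v \<phi> = e *\<^sub>R \<phi>" for i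
    using nz[OF u(2)] by (auto simp: \<phi>_def)
  show ?thesis
  proof
    show "norm \<phi> = 1" using u(1) by (simp add: \<phi>_def norm_vec_def)
    fix v :: "real^'m" assume v: "h *v v = e *\<^sub>R v"
    fix i :: 'm
    define c where "c = v $ i / \<phi> $ i"
    have "h *v (v - c *\<^sub>R \<phi>) = e *\<^sub>R (v - c *\<^sub>R \<phi>)"
      by (simp add: matrix_vector_mult_diff_distrib matrix_vector_mult_scaleR v eig scaleR_diff_right)
    moreover have "(v - c *\<^sub>R \<phi>) $ i = 0" using pos[of i] by (simp add: c_def)
    ultimately have "v - c *\<^sub>R \<phi> = 0" using nz(2) by blast
    then show "\<exists>c. v = c *\<^sub>R \<phi>" by auto
  qed (use pos eig ge in auto)
qed

subsection \<open>Complex inner products and positive semidefinite matrices\<close>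

text \<open>Complex vectors are treated as a real inner product space, so that the Rayleigh lemmas
  serve matrices over both fields.\<close>

lemma real_linear_mult: "linear ((*v) (A :: complex^'n^'k))"
proof (rule linearI)
  show "A *v (c *\<^sub>R x) = c *\<^sub>R (A *v x)" for c x
    by (simp add: vec_eq_iff matrix_vector_mult_def scaleR_sum_right)
qed (rule matrix_vector_right_distrib)

lemma Re_cinner: "Re (cinner x y) = x \<bullet> y"
  by (simp add: cinner_def inner_vec_def inner_complex_def)

lemma cinner_adjoint_mat: "cinner x (A *v y) = cinner (adjoint_mat A *v x) y"
proof -
  have "cinner x (A *v y) = (\<Sum>i\<in>UNIV. \<Sum>j\<in>UNIV. cnj (x $ i) * A $ i $ j * y $ j)"
    by (simp add: cinner_def matrix_vector_mult_def sum_distrib_left mult_ac)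
  also have "\<dots> = (\<Sum>j\<in>UNIV. \<Sum>i\<in>UNIV. cnj (x $ i) * A $ i $ j * y $ j)"
    by (rule sum.swap)
  also have "\<dots> = cinner (adjoint_mat A *v x) y"
    by (simp add: cinner_def adjoint_mat_def matrix_vector_mult_def sum_distrib_left sum_distrib_right
        mult_ac)
  finally show ?thesis .
qed

text \<open>Cholesky elimination: subtracting the normalised column of a nonzero pivot preserves positivity
  and removes one nonzero diagonal entry.\<close>

lemma psd_rank_one_decomposition:
  fixes \<Gamma> :: "complex^'n^'n"
  assumes "hermitian \<Gamma>" and "\<And>x. 0 \<le> Re (cinner x (\<Gamma> *v x))"
  shows "\<exists>(n::nat) v. \<forall>i j. \<Gamma> $ i $ j = (\<Sum>k<n. v k $ i * cnj (v k $ j))"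
  using assms
proof (induction "card {i. \<Gamma> $ i $ i \<noteq> 0}" arbitrary: \<Gamma> rule: less_induct)
  case less
  have herm: "\<Gamma> $ i $ j = cnj (\<Gamma> $ j $ i)" for i j using less.prems(1) unfolding hermitian_def by blast
  have ent: "cinner (axis i a) (\<Gamma> *v x) = cnj a * (\<Gamma> *v x) $ i" for i a x
    by (simp add: cinner_def axis_def if_distrib[of cnj] mult_delta_left cong: if_cong)
  have col: "(\<Gamma> *v axis i a) $ j = \<Gamma> $ j $ i * a" for i j a
    by (simp add: matrix_vector_mult_def axis_def mult_delta_right)
  have addl: "cinner (x + y) z = cinner x z + cinner y z"
    and addr: "cinner z (x + y) = cinner z x + cinner z y" for x y z :: "complex^'n"
    by (simp_all add: cinner_def sum.distrib algebra_simps)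
  have "adjoint_mat \<Gamma> = \<Gamma>" by (simp add: adjoint_mat_def vec_eq_iff herm[symmetric])
  then have "cinner x (\<Gamma> *v y) = cinner (\<Gamma> *v x) y" for x y
    using cinner_adjoint_mat[of x \<Gamma> y] by simp
  then have sa: "cinner x (\<Gamma> *v y) = cnj (cinner y (\<Gamma> *v x))" for x y
    by (simp add: cinner_def mult.commute)
  have expand: "cinner (x + axis i a) (\<Gamma> *v (x + axis i a)) =
     cinner x (\<Gamma> *v x) + cnj a * (\<Gamma> *v x) $ i + cnj (cnj a * (\<Gamma> *v x) $ i) + cnj a * a * \<Gamma> $ i $ i"
    for x i a
    by (simp add: matrix_vector_right_distrib addl addr sa[of x "axis i a"] ent col mult_ac)
  have diag: "Im (\<Gamma> $ i $ i) = 0" "0 \<le> Re (\<Gamma> $ i $ i)" for i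
    using arg_cong[OF herm[of i i], of Im] less.prems(2)[of "axis i 1"]
    by (simp_all add: ent col)
  show ?case
  proof (cases "\<forall>i. \<Gamma> $ i $ i = 0")
    case True
    have "\<Gamma> $ i $ j = 0" for i j
    proof -
      \<comment> \<open>With zero diagonal only the cross terms
        \<open>2 Re (cnj a * \<Gamma> $ i $ j)\<close> survive, and this \<open>a\<close> makes them
        negative unless the entry is zero.\<close>
      define a where "a = - \<Gamma> $ i $ j"
      have "0 \<le> Re (cinner (axis j 1 + axis i a) (\<Gamma> *v (axis j 1 + axis i a)))"
        by (rule less.prems)
      also have "\<dots> = - 2 * (cmod (\<Gamma> $ i $ j))\<^sup>2"
        unfolding expand cmod_power2
        by (simp add: ent col True a_def power2_eq_square)
      finally show ?thesis by simp
    qed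
    then show ?thesis by (intro exI[of _ 0]) simp
  next
    case False
    then obtain i where i: "\<Gamma> $ i $ i \<noteq> 0" by blast
    define g where "g = Re (\<Gamma> $ i $ i)"
    have g: "0 < g" "\<Gamma> $ i $ i = complex_of_real g"
      using i diag[of i] by (auto simp: g_def complex_eq_iff less_le)
    define u where "u = (\<chi> j. \<Gamma> $ j $ i / complex_of_real (sqrt g))"
    have uu: "u $ j * cnj (u $ k) = \<Gamma> $ j $ i * \<Gamma> $ i $ k / g" for j k
    proof -
      have "complex_of_real (sqrt g) * complex_of_real (sqrt g) = g"
        using g by (simp flip: of_real_mult)
      then show ?thesis by (simp add: u_def herm[of i k] times_divide_times_eq)
    qed
    define \<Gamma>' where "\<Gamma>' = (\<chi> j k. \<Gamma> $ j $ k - u $ j * cnj (u $ k))"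
    have "hermitian \<Gamma>'"
      by (auto simp: hermitian_def \<Gamma>'_def herm[symmetric])
    moreover have "0 \<le> Re (cinner x (\<Gamma>' *v x))" for x
    proof -
      let ?y = "(\<Gamma> *v x) $ i"
      have "cinner x (\<Gamma>' *v x) = cinner x (\<Gamma> *v x)
          - (\<Sum>j\<in>UNIV. cnj (x $ j) * \<Gamma> $ j $ i) * (\<Sum>k\<in>UNIV. \<Gamma> $ i $ k * x $ k) / g"
        unfolding sum_product
        by (simp add: cinner_def matrix_vector_mult_def \<Gamma>'_def uu sum_distrib_left sum_subtractf
            algebra_simps sum_divide_distrib)
      also have "(\<Sum>j\<in>UNIV. cnj (x $ j) * \<Gamma> $ j $ i) = cnj ?y"
        by (simp add: matrix_vector_mult_def herm[symmetric] mult.commute)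
      also have "(\<Sum>k\<in>UNIV. \<Gamma> $ i $ k * x $ k) = ?y" by (simp add: matrix_vector_mult_def)
      \<comment> \<open>Completing the square: the reduced form at \<open>x\<close> is the minimum
        of the old form over all shifts of \<open>x\<close> along \<open>axis i\<close>.\<close>
      also have "cinner x (\<Gamma> *v x) - cnj ?y * ?y / g =
          cinner (x + axis i (- ?y / g)) (\<Gamma> *v (x + axis i (- ?y / g)))"
        unfolding expand using g by (simp add: field_simps)
      finally show ?thesis using less.prems(2) by simp
    qed
    moreover have "card {j. \<Gamma>' $ j $ j \<noteq> 0} < card {j. \<Gamma> $ j $ j \<noteq> 0}"
    proof (rule psubset_card_mono)
      \<comment> \<open>A zero diagonal entry of a positive matrix forces a zero row, so elimination
        does not disturb it.\<close>
      have "\<Gamma>' $ j $ j = 0" if "\<Gamma> $ j $ j = 0" for j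
      proof -
        have "\<Gamma> $ j $ i = 0"
        proof (rule ccontr)
          assume nz: "\<Gamma> $ j $ i \<noteq> 0"
          \<comment> \<open>As \<open>\<Gamma> $ j $ j = 0\<close>, the form is affine in
            \<open>t\<close>; this value makes it \<open>- g\<close>.\<close>
          define t where "t = g / (cmod (\<Gamma> $ j $ i))\<^sup>2"
          define a where "a = - t * \<Gamma> $ j $ i"
          have "0 \<le> Re (cinner (axis i 1 + axis j a) (\<Gamma> *v (axis i 1 + axis j a)))"
            by (rule less.prems)
          also have "\<dots> = g - 2 * t * (cmod (\<Gamma> $ j $ i))\<^sup>2"
            unfolding expand cmod_power2
            by (simp add: ent col that g a_def power2_eq_square algebra_simps)
          also have "\<dots> = - g" using nz by (simp add: t_def)
          finally show False using g by simp
        qed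
        then show ?thesis using that by (simp add: \<Gamma>'_def uu)
      qed
      moreover have "\<Gamma>' $ i $ i = 0" using g by (simp add: \<Gamma>'_def uu)
      ultimately show "{j. \<Gamma>' $ j $ j \<noteq> 0} \<subset> {j. \<Gamma> $ j $ j \<noteq> 0}" using i by blast
    qed simp
    ultimately obtain n :: nat and v where "\<And>j k. \<Gamma>' $ j $ k = (\<Sum>l<n. v l $ j * cnj (v l $ k))"
      using less.hyps by blast
    then have "\<Gamma> $ j $ k = (\<Sum>l<Suc n. (v(n := u)) l $ j * cnj ((v(n := u)) l $ k))" for j k
      by (simp add: \<Gamma>'_def algebra_simps eq_diff_eq)
    then show ?thesis by blast
  qed
qed

subsection \<open>Canonical anticommutation relations\<close>

text \<open>The Jordan-Wigner sign. Only modes strictly below \<open>i\<close> count, so it is the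
  same with and without \<open>i\<close> in the set.\<close>

definition fermi_sign :: "'m::{finite,linorder} \<Rightarrow> 'm set \<Rightarrow> complex" where
  "fermi_sign i I = (- 1) ^ card {j \<in> I. j < i}"

lemma fermi_sign_square [simp]: "fermi_sign i I * fermi_sign i I = 1"
  by (simp add: fermi_sign_def flip: power_mult_distrib)

lemma fermi_sign_insert:
  "fermi_sign i (insert j I) = (if j < i \<and> j \<notin> I then - fermi_sign i I else fermi_sign i I)"
proof -
  have "{k \<in> insert j I. k < i} = (if j < i then insert j {k \<in> I. k < i} else {k \<in> I. k < i})"
    by auto
  then show ?thesis by (auto simp: fermi_sign_def card_insert_if)
qed

lemma fermi_sign_remove:
  "fermi_sign i (I - {j}) = (if j < i \<and> j \<in> I then - fermi_sign i I else fermi_sign i I)"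
proof (cases "j \<in> I")
  case True
  then show ?thesis using fermi_sign_insert[of i j "I - {j}"] by (auto simp: insert_absorb)
qed simp

lemma creation_mult_nth:
  "(creation i *v \<Psi>) $ I = (if i \<in> I then fermi_sign i I * \<Psi> $ (I - {i}) else 0)"
proof -
  have "creation i $ I $ J * \<Psi> $ J =
      (if J = I - {i} then (if i \<in> I then fermi_sign i I * \<Psi> $ J else 0) else 0)" for J
    using fermi_sign_remove[of i I i] by (auto simp: creation_def fermi_sign_def insert_absorb)
  then show ?thesis by (simp add: matrix_vector_mult_def)
qed

lemma annihilation_mult_nth:
  "(annihilation i *v \<Psi>) $ I = (if i \<in> I then 0 else fermi_sign i I * \<Psi> $ insert i I)"
proof -
  have "annihilation i $ I $ J * \<Psi> $ J =
      (if J = insert i I then (if i \<in> I then 0 else fermi_sign i I * \<Psi> $ J) else 0)" for J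
    by (auto simp: annihilation_def adjoint_mat_def creation_def fermi_sign_def)
  then show ?thesis by (simp add: matrix_vector_mult_def)
qed

text \<open>For distinct modes, removing the smaller one flips the sign of the larger one but not
  conversely; for equal modes both sides vanish.\<close>

lemma creation_anticommute:
  "creation i *v (creation j *v \<Psi>) = - (creation j *v (creation i *v \<Psi>))"
proof (subst vec_eq_iff, intro allI)
  fix I
  have comm: "A - B - C = A - C - B" for A B C :: "'a set" by auto
  show "(creation i *v (creation j *v \<Psi>)) $ I = (- (creation j *v (creation i *v \<Psi>))) $ I"
    by (cases i j rule: linorder_cases) (auto simp: creation_mult_nth fermi_sign_remove comm)
qed

lemma annihilation_anticommute:
  "annihilation i *v (annihilation j *v \<Psi>) = - (annihilation j *v (annihilation i *v \<Psi>))"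
proof (subst vec_eq_iff, intro allI)
  fix I
  show "(annihilation i *v (annihilation j *v \<Psi>)) $ I
      = (- (annihilation j *v (annihilation i *v \<Psi>))) $ I"
    by (cases i j rule: linorder_cases) (auto simp: annihilation_mult_nth fermi_sign_insert insert_commute)
qed

text \<open>The mixed anticommutation relation, solved for the wrong order so that it rewrites to
  normal order.\<close>

lemma annihilation_creation:
  "annihilation i *v (creation j *v \<Psi>) =
     (if i = j then \<Psi> else 0) - creation j *v (annihilation i *v \<Psi>)"
proof (subst vec_eq_iff, intro allI)
  fix I
  show "(annihilation i *v (creation j *v \<Psi>)) $ I =
     ((if i = j then \<Psi> else 0) - creation j *v (annihilation i *v \<Psi>)) $ I"
    by (cases i j rule: linorder_cases)
      (auto simp: creation_mult_nth annihilation_mult_nth fermi_sign_insert fermi_sign_remove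
        insert_Diff_if insert_absorb simp flip: mult.assoc)
qed

section \<open>Particle-number sectors and number operators\<close>

lemma subspace_sector: "subspace (sector N)"
  by (auto simp: sector_def subspace_def)

lemma creation_sector:
  assumes "\<Psi> \<in> sector N"
  shows "creation i *v \<Psi> \<in> sector (Suc N)"
proof -
  have "(creation i *v \<Psi>) $ I = 0" if "card I \<noteq> Suc N" for I
  proof (cases "i \<in> I")
    case True
    then have "card (I - {i}) \<noteq> N" using that card_Suc_Diff1[of I i] by auto
    then have "\<Psi> $ (I - {i}) = 0" using assms unfolding sector_def by blast
    then show ?thesis by (simp add: creation_mult_nth)
  qed (simp add: creation_mult_nth)
  then show ?thesis by (simp add: sector_def)
qed

lemma annihilation_sector: "\<Psi> \<in> sector (Suc N) \<Longrightarrow> annihilation i *v \<Psi> \<in> sector N"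
  by (auto simp: sector_def annihilation_mult_nth)

lemma number_op_mult: "number_op i *v \<Psi> = creation i *v (annihilation i *v \<Psi>)"
  by (simp add: number_op_def matrix_vector_mul_assoc)

lemma number_op_mult_nth: "(number_op i *v \<Psi>) $ I = (if i \<in> I then \<Psi> $ I else 0)"
  by (auto simp: number_op_mult creation_mult_nth annihilation_mult_nth fermi_sign_remove
      insert_absorb simp flip: mult.assoc)

lemma sum_number_op:
  assumes "\<Psi> \<in> sector N"
  shows "(\<Sum>i\<in>UNIV. number_op i *v \<Psi>) = real N *\<^sub>R \<Psi>"
proof (subst vec_eq_iff, intro allI)
  fix I
  have "(\<Sum>i\<in>UNIV. number_op i *v \<Psi>) $ I = of_nat (card I) * \<Psi> $ I"
    by (simp add: number_op_mult_nth sum.If_cases)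
  also have "\<dots> = (real N *\<^sub>R \<Psi>) $ I"
    unfolding vector_scaleR_component unfolding scaleR_conv_of_real
    using assms by (cases "card I = N") (auto simp: sector_def)
  finally show "(\<Sum>i\<in>UNIV. number_op i *v \<Psi>) $ I = (real N *\<^sub>R \<Psi>) $ I" .
qed

lemma inner_creation: "x \<bullet> (creation i *v y) = (annihilation i *v x) \<bullet> y"
  by (simp add: annihilation_def cinner_adjoint_mat flip: Re_cinner)

text \<open>Reduces positivity of a density to showing that no ground state is killed by
  \<open>annihilation i\<close>.\<close>

lemma Re_cinner_number_op: "Re (cinner \<Psi> (number_op i *v \<Psi>)) = (norm (annihilation i *v \<Psi>))\<^sup>2"
  by (simp add: Re_cinner number_op_mult inner_creation power2_norm_eq_inner)

subsection \<open>The Hamiltonian and the smeared operators\<close>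

lemma hamiltonian_mult:
  "hamiltonian (complexify h) *v \<Psi> =
     (\<Sum>i\<in>UNIV. \<Sum>j\<in>UNIV. h $ i $ j *\<^sub>R (creation i *v (annihilation j *v \<Psi>)))"
proof -
  have "(hamiltonian (complexify h) *v \<Psi>) $ I =
      (\<Sum>i\<in>UNIV. \<Sum>j\<in>UNIV. complex_of_real (h $ i $ j) * ((creation i ** annihilation j) *v \<Psi>) $ I)" for I
  proof -
    have "(hamiltonian (complexify h) *v \<Psi>) $ I = (\<Sum>J\<in>UNIV. \<Sum>i\<in>UNIV. \<Sum>j\<in>UNIV.
        complex_of_real (h $ i $ j) * (creation i ** annihilation j) $ I $ J * \<Psi> $ J)"
      by (simp add: matrix_vector_mult_def hamiltonian_def map_matrix_def sum_distrib_right)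
    also have "\<dots> = (\<Sum>i\<in>UNIV. \<Sum>J\<in>UNIV. \<Sum>j\<in>UNIV.
        complex_of_real (h $ i $ j) * (creation i ** annihilation j) $ I $ J * \<Psi> $ J)"
      by (rule sum.swap)
    also have "\<dots> = (\<Sum>i\<in>UNIV. \<Sum>j\<in>UNIV. \<Sum>J\<in>UNIV.
        complex_of_real (h $ i $ j) * (creation i ** annihilation j) $ I $ J * \<Psi> $ J)"
      by (intro sum.cong refl sum.swap)
    finally show ?thesis
      by (simp add: matrix_vector_mult_def sum_distrib_left mult.assoc)
  qed
  then show ?thesis
    by (simp add: vec_eq_iff matrix_vector_mul_assoc) (simp add: scaleR_conv_of_real)
qed

lemma hamiltonian_sector:
  assumes "\<Psi> \<in> sector N"
  shows "hamiltonian (complexify h) *v \<Psi> \<in> sector N"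
proof (cases N)
  \<comment> \<open>No sector lies below the vacuum; there every annihilation operator gives
    zero.\<close>
  case 0
  then have "annihilation j *v \<Psi> = 0" for j
    using assms by (auto simp: vec_eq_iff annihilation_mult_nth sector_def)
  then show ?thesis
    by (simp add: hamiltonian_mult sector_def)
next
  case (Suc n)
  then show ?thesis unfolding hamiltonian_mult
    using assms by (intro subspace_sum[OF subspace_sector] subspace_scale[OF subspace_sector])
      (auto intro: creation_sector annihilation_sector)
qed

lemma inner_hamiltonian:
  fixes h :: "real^('m::{finite,linorder})^('m::{finite,linorder})"
  assumes "transpose h = h"
  shows "(hamiltonian (complexify h) *v x) \<bullet> y = x \<bullet> (hamiltonian (complexify h) *v y)"
proof -
  have c: "(creation i *v u) \<bullet> w = u \<bullet> (annihilation i *v w)" for i :: 'm and u w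
    by (simp add: inner_commute[of _ w] inner_creation inner_commute[of u])
  have "(hamiltonian (complexify h) *v x) \<bullet> y
      = (\<Sum>i\<in>UNIV. \<Sum>j\<in>UNIV. h $ i $ j * ((annihilation j *v x) \<bullet> (annihilation i *v y)))"
    by (simp add: hamiltonian_mult inner_sum_left c)
  also have "\<dots> = (\<Sum>j\<in>UNIV. \<Sum>i\<in>UNIV. h $ i $ j * ((annihilation j *v x) \<bullet> (annihilation i *v y)))"
    by (rule sum.swap)
  also have "\<dots> = (\<Sum>j\<in>UNIV. \<Sum>i\<in>UNIV. h $ j $ i * ((annihilation j *v x) \<bullet> (annihilation i *v y)))"
    by (intro sum.cong refl) (metis transpose_eq_self_nth[OF assms])
  also have "\<dots> = x \<bullet> (hamiltonian (complexify h) *v y)"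
    by (simp add: hamiltonian_mult inner_sum_right inner_creation)
  finally show ?thesis .
qed

text \<open>The field operators a^dagger(v) and a(v). With real coefficients the second one is
  linear in \<open>v\<close>, not antilinear.\<close>

definition smeared_creation ::
    "real^'m::{finite,linorder} \<Rightarrow> complex^('m set) \<Rightarrow> complex^('m set)" where
  "smeared_creation v \<Psi> = (\<Sum>k\<in>UNIV. v $ k *\<^sub>R (creation k *v \<Psi>))"

definition smeared_annihilation ::
    "real^'m::{finite,linorder} \<Rightarrow> complex^('m set) \<Rightarrow> complex^('m set)" where
  "smeared_annihilation v \<Psi> = (\<Sum>k\<in>UNIV. v $ k *\<^sub>R (annihilation k *v \<Psi>))"

section \<open>Commutation relations of the Hamiltonian and the field operators\<close>

lemmas fock_linear_simps =
  linear_sum[OF real_linear_mult] linear_scale[OF real_linear_mult] linear_add[OF real_linear_mult]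
  linear_diff[OF real_linear_mult] linear_neg[OF real_linear_mult]

text \<open>Moving \<open>creation k\<close> through a creation-annihilation pair costs two signs,
  which cancel; only the contraction with \<open>annihilation k\<close> remains.\<close>

lemma hamiltonian_creation:
  "hamiltonian (complexify h) *v (creation k *v \<Psi>) =
     creation k *v (hamiltonian (complexify h) *v \<Psi>) + (\<Sum>i\<in>UNIV. h $ i $ k *\<^sub>R (creation i *v \<Psi>))"
proof -
  have "creation i *v (annihilation j *v (creation k *v \<Psi>)) =
      (if j = k then creation i *v \<Psi> else 0) + creation k *v (creation i *v (annihilation j *v \<Psi>))" for i j
    by (simp add: annihilation_creation fock_linear_simps creation_anticommute[of i k])
  then show ?thesis
    by (simp add: hamiltonian_mult fock_linear_simps scaleR_add_right sum.distrib
        if_distrib[of "scaleR _"] cong: if_cong)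
qed

lemma hamiltonian_annihilation:
  "hamiltonian (complexify h) *v (annihilation k *v \<Psi>) =
     annihilation k *v (hamiltonian (complexify h) *v \<Psi>) - (\<Sum>j\<in>UNIV. h $ k $ j *\<^sub>R (annihilation j *v \<Psi>))"
proof -
  have "creation i *v (annihilation j *v (annihilation k *v \<Psi>)) =
      annihilation k *v (creation i *v (annihilation j *v \<Psi>)) - (if k = i then annihilation j *v \<Psi> else 0)" for i j
    by (simp add: annihilation_creation fock_linear_simps annihilation_anticommute[of j k])
  then have "hamiltonian (complexify h) *v (annihilation k *v \<Psi>) =
     annihilation k *v (hamiltonian (complexify h) *v \<Psi>)
     - (\<Sum>i\<in>UNIV. \<Sum>j\<in>UNIV. if k = i then h $ i $ j *\<^sub>R (annihilation j *v \<Psi>) else 0)"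
    by (simp add: hamiltonian_mult fock_linear_simps scaleR_diff_right sum_subtractf
        if_distrib[of "scaleR _"] cong: if_cong)
  also have "(\<Sum>i\<in>UNIV. \<Sum>j\<in>UNIV. if k = i then h $ i $ j *\<^sub>R (annihilation j *v \<Psi>) else 0)
     = (\<Sum>j\<in>UNIV. \<Sum>i\<in>UNIV. if k = i then h $ i $ j *\<^sub>R (annihilation j *v \<Psi>) else 0)"
    by (rule sum.swap)
  finally show ?thesis by simp
qed

text \<open>The commutator [H, a^dagger(v)] = a^dagger(h v): adding an eigenmode of \<open>h\<close>
  raises the energy by its eigenvalue.\<close>

lemma hamiltonian_smeared_creation:
  "hamiltonian (complexify h) *v smeared_creation v \<Psi> =
     smeared_creation v (hamiltonian (complexify h) *v \<Psi>) + smeared_creation (h *v v) \<Psi>"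
proof -
  have "(\<Sum>k\<in>UNIV. \<Sum>i\<in>UNIV. (v $ k * h $ i $ k) *\<^sub>R (creation i *v \<Psi>))
      = (\<Sum>i\<in>UNIV. \<Sum>k\<in>UNIV. (v $ k * h $ i $ k) *\<^sub>R (creation i *v \<Psi>))" by (rule sum.swap)
  moreover have "(h *v v) $ i = (\<Sum>k\<in>UNIV. v $ k * h $ i $ k)" for i
    by (simp add: matrix_vector_mult_def mult.commute)
  ultimately show ?thesis
    by (simp add: smeared_creation_def fock_linear_simps hamiltonian_creation scaleR_add_right
        sum.distrib scaleR_sum_right scaleR_sum_left)
qed

text \<open>The commutator [H, a(v)] = - a(h v): removing an eigenmode lowers the energy by its
  eigenvalue. Symmetry replaces the transpose of \<open>h\<close>, which arises here, by
  \<open>h\<close>.\<close>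

lemma hamiltonian_smeared_annihilation:
  assumes "transpose h = h"
  shows "hamiltonian (complexify h) *v smeared_annihilation v \<Psi> =
     smeared_annihilation v (hamiltonian (complexify h) *v \<Psi>) - smeared_annihilation (h *v v) \<Psi>"
proof -
  have "(\<Sum>k\<in>UNIV. \<Sum>i\<in>UNIV. (v $ k * h $ k $ i) *\<^sub>R (annihilation i *v \<Psi>))
      = (\<Sum>i\<in>UNIV. \<Sum>k\<in>UNIV. (v $ k * h $ k $ i) *\<^sub>R (annihilation i *v \<Psi>))" by (rule sum.swap)
  also have "\<dots> = (\<Sum>i\<in>UNIV. \<Sum>k\<in>UNIV. (v $ k * h $ i $ k) *\<^sub>R (annihilation i *v \<Psi>))"
    by (intro sum.cong refl) (metis transpose_eq_self_nth[OF assms])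
  finally have "(\<Sum>k\<in>UNIV. \<Sum>i\<in>UNIV. (v $ k * h $ k $ i) *\<^sub>R (annihilation i *v \<Psi>))
      = (\<Sum>i\<in>UNIV. \<Sum>k\<in>UNIV. (v $ k * h $ i $ k) *\<^sub>R (annihilation i *v \<Psi>))" .
  moreover have "(h *v v) $ i = (\<Sum>k\<in>UNIV. v $ k * h $ i $ k)" for i
    by (simp add: matrix_vector_mult_def mult.commute)
  ultimately show ?thesis
    by (simp add: smeared_annihilation_def fock_linear_simps hamiltonian_annihilation scaleR_diff_right
        sum_subtractf scaleR_sum_right scaleR_sum_left)
qed

lemma smeared_creation_scale: "smeared_creation (c *\<^sub>R v) \<Psi> = c *\<^sub>R smeared_creation v \<Psi>"
  "smeared_creation v (c *\<^sub>R \<Psi>) = c *\<^sub>R smeared_creation v \<Psi>"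
  "smeared_creation v 0 = 0"
  by (simp_all add: smeared_creation_def scaleR_sum_right fock_linear_simps mult_ac)

lemma linear_smeared_annihilation: "linear (\<lambda>v. smeared_annihilation v \<Psi>)"
  by (rule linearI) (simp_all add: smeared_annihilation_def scaleR_add_left sum.distrib scaleR_sum_right)

lemma smeared_annihilation_scale:
  "smeared_annihilation v (c *\<^sub>R \<Psi>) = c *\<^sub>R smeared_annihilation v \<Psi>"
  by (simp add: smeared_annihilation_def scaleR_sum_right fock_linear_simps mult_ac)

lemma smeared_annihilation_axis: "smeared_annihilation (axis i 1) \<Psi> = annihilation i *v \<Psi>"
  by (simp add: smeared_annihilation_def axis_def if_distrib[of "\<lambda>c. c *\<^sub>R _"] cong: if_cong)

lemma smeared_creation_sector: "\<Psi> \<in> sector N \<Longrightarrow> smeared_creation v \<Psi> \<in> sector (Suc N)"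
  unfolding smeared_creation_def
  by (intro subspace_sum[OF subspace_sector] subspace_scale[OF subspace_sector] creation_sector)

lemma smeared_annihilation_sector: "\<Psi> \<in> sector (Suc N) \<Longrightarrow> smeared_annihilation v \<Psi> \<in> sector N"
  unfolding smeared_annihilation_def
  by (intro subspace_sum[OF subspace_sector] subspace_scale[OF subspace_sector] annihilation_sector)

lemma annihilation_smeared_creation:
  "annihilation i *v smeared_creation v \<Psi> = v $ i *\<^sub>R \<Psi> - smeared_creation v (annihilation i *v \<Psi>)"
  by (simp add: smeared_creation_def fock_linear_simps annihilation_creation scaleR_diff_right
      sum_subtractf if_distrib[of "scaleR _"] cong: if_cong)

lemma smeared_annihilation_creation:
  "smeared_annihilation u (smeared_creation v \<Psi>) =
     (u \<bullet> v) *\<^sub>R \<Psi> - smeared_creation v (smeared_annihilation u \<Psi>)"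
proof -
  have "(\<Sum>i\<in>UNIV. u $ i *\<^sub>R smeared_creation v (annihilation i *v \<Psi>)) =
      smeared_creation v (smeared_annihilation u \<Psi>)"
    unfolding smeared_creation_def smeared_annihilation_def
    by (simp add: fock_linear_simps scaleR_sum_right mult_ac) (rule sum.swap)
  then show ?thesis
    unfolding smeared_annihilation_def[of u "smeared_creation v \<Psi>"]
    by (simp add: annihilation_smeared_creation scaleR_diff_right sum_subtractf inner_vec_def
        scaleR_sum_left)
qed

text \<open>Pauli principle: symmetric coefficients meet anticommuting operators, so the double sum
  equals its own negative.\<close>

lemma smeared_creation_nilpotent: "smeared_creation v (smeared_creation v \<Psi>) = 0"
proof -
  let ?s = "smeared_creation v (smeared_creation v \<Psi>)"
  have "?s = (\<Sum>i\<in>UNIV. \<Sum>j\<in>UNIV. (v $ i * v $ j) *\<^sub>R (creation i *v (creation j *v \<Psi>)))"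
    by (simp add: smeared_creation_def fock_linear_simps scaleR_sum_right)
  also have "\<dots> = (\<Sum>j\<in>UNIV. \<Sum>i\<in>UNIV. (v $ i * v $ j) *\<^sub>R (creation i *v (creation j *v \<Psi>)))"
    by (rule sum.swap)
  also have "\<dots> = - (\<Sum>j\<in>UNIV. \<Sum>i\<in>UNIV. (v $ j * v $ i) *\<^sub>R (creation j *v (creation i *v \<Psi>)))"
    by (subst creation_anticommute) (simp add: sum_negf mult.commute)
  also have "\<dots> = - ?s"
    by (simp add: smeared_creation_def fock_linear_simps scaleR_sum_right)
  finally have "2 *\<^sub>R ?s = 0" by (simp add: scaleR_2)
  then show ?thesis by simp
qed

text \<open>If adding the mode \<open>\<phi>\<close> to \<open>\<Psi>\<close> gave a nonzero state \<open>X\<close>, then removing from \<open>X\<close> an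
  eigenmode orthogonal to \<open>\<phi>\<close> would give energy strictly below \<open>E\<close>, hence zero. So all \<open>N + 1\<close>
  particles of \<open>X\<close> would occupy the single mode \<open>\<phi>\<close>, against the Pauli principle.\<close>

lemma ground_state_occupies_lowest_mode:
  fixes h :: "real^('m::{finite,linorder})^('m::{finite,linorder})"
  assumes sym: "transpose h = h"
    and \<phi>: "norm \<phi> = 1" "h *v \<phi> = e *\<^sub>R \<phi>"
    and ge: "\<And>x. e * (x \<bullet> x) \<le> x \<bullet> (h *v x)"
    and simple: "\<And>u. h *v u = e *\<^sub>R u \<Longrightarrow> \<exists>c. u = c *\<^sub>R \<phi>"
    and N: "1 \<le> N" and \<Psi>: "\<Psi> \<in> sector N" "hamiltonian (complexify h) *v \<Psi> = E *\<^sub>R \<Psi>"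
    and least: "\<And>E' X. \<lbrakk>X \<in> sector N; X \<noteq> 0; hamiltonian (complexify h) *v X = E' *\<^sub>R X\<rbrakk> \<Longrightarrow> E \<le> E'"
  shows "smeared_creation \<phi> \<Psi> = 0"
proof -
  let ?H = "hamiltonian (complexify h)"
  define X where "X = smeared_creation \<phi> \<Psi>"
  have X: "X \<in> sector (Suc N)" unfolding X_def by (rule smeared_creation_sector[OF \<Psi>(1)])
  have HX: "?H *v X = (E + e) *\<^sub>R X"
    by (simp add: X_def hamiltonian_smeared_creation \<Psi> \<phi> smeared_creation_scale scaleR_add_left)
  interpret ann: linear "\<lambda>v. smeared_annihilation v X" by (rule linear_smeared_annihilation)
  \<comment> \<open>\<open>V\<close> holds the modes orthogonal to \<open>\<phi>\<close> that are
    empty in \<open>X\<close>, and \<open>U\<close> is its complement inside the orthogonal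
    complement of \<open>\<phi>\<close>. The aim is \<open>U = {0}\<close>.\<close>
  define V where "V = {v. smeared_annihilation v X = 0 \<and> v \<bullet> \<phi> = 0}"
  define U where "U = {u. u \<bullet> \<phi> = 0 \<and> (\<forall>v\<in>V. u \<bullet> v = 0)}"
  have perp: "(h *v v) \<bullet> \<phi> = 0" if "v \<bullet> \<phi> = 0" for v
    using that by (simp add: symmetric_inner_mult[OF sym] \<phi>)
  have Hann: "?H *v smeared_annihilation v X = (E + e) *\<^sub>R smeared_annihilation v X
      - smeared_annihilation (h *v v) X" for v
    by (simp add: hamiltonian_smeared_annihilation[OF sym] HX smeared_annihilation_scale)
  have V_inv: "h *v v \<in> V" if "v \<in> V" for v
    using that Hann[of v] perp[of v] by (simp add: V_def)
  have V_sub: "subspace V"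
    by (auto simp: V_def subspace_def ann.add ann.scale ann.zero inner_add_left)
  have U_sub: "subspace U"
    by (auto simp: U_def subspace_def inner_add_left)
  have U_inv: "h *v u \<in> U" if "u \<in> U" for u
    using that V_inv perp by (auto simp: U_def symmetric_inner_mult[OF sym])
  have U0: "u = 0" if u: "u \<in> U" for u
  proof (rule ccontr)
    assume "u \<noteq> 0"
    \<comment> \<open>A nonzero invariant \<open>U\<close> contains an eigenmode of
      \<open>h\<close>. Being orthogonal to \<open>\<phi>\<close>, it has \<open>l > e\<close>;
      removing it from \<open>X\<close> leaves energy below \<open>E\<close>, so it is empty and
      lies in both \<open>U\<close> and \<open>V\<close>.\<close>
    obtain w l where w: "w \<in> U" "norm w = 1" "h *v w = l *\<^sub>R w"
      by (rule selfadjoint_least_eigenvalue[of "(*v) h" U u])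
        (use u \<open>u \<noteq> 0\<close> U_sub U_inv in \<open>auto simp: symmetric_inner_mult[OF sym]\<close>)
    have ww: "w \<bullet> w = 1" using w(2) by (simp add: norm_eq_1)
    have "l \<noteq> e"
    proof
      assume "l = e"
      then obtain c where "w = c *\<^sub>R \<phi>" using simple w(3) by auto
      moreover have "w \<bullet> \<phi> = 0" using w(1) by (simp add: U_def)
      ultimately show False using ww by (metis inner_scaleR_right mult_zero_right zero_neq_one)
    qed
    moreover have "e \<le> l" using ge[of w] by (simp add: w(3) ww)
    ultimately have "E + e - l < E" by simp
    moreover have "?H *v smeared_annihilation w X = (E + e - l) *\<^sub>R smeared_annihilation w X"
      by (simp add: Hann w(3) ann.scale scaleR_diff_left)
    ultimately have "smeared_annihilation w X = 0"
      using least[OF smeared_annihilation_sector[OF X]] by fastforce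
    then have "w \<in> V" using w(1) by (simp add: V_def U_def)
    then show False using w(1) ww by (auto simp: U_def)
  qed
  have V_all: "x \<in> V" if x: "x \<bullet> \<phi> = 0" for x
  proof -
    obtain y z where "y \<in> span V" and z: "\<And>v. v \<in> span V \<Longrightarrow> orthogonal z v" and xyz: "x = y + z"
      using orthogonal_subspace_decomp_exists[of V x] by metis
    then have y: "y \<in> V" using V_sub by (simp add: span_eq_iff[THEN iffD2])
    then have "z \<bullet> \<phi> = 0" using x by (simp add: xyz V_def inner_add_left)
    then have "z \<in> U" using z by (auto simp: U_def orthogonal_def span_base)
    then have "z = 0" by (rule U0)
    then show ?thesis using y xyz by simp
  qed
  have \<phi>\<phi>: "\<phi> \<bullet> \<phi> = 1" using \<phi>(1) by (simp add: norm_eq_1)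
  have occ: "annihilation i *v X = \<phi> $ i *\<^sub>R smeared_annihilation \<phi> X" for i
  proof -
    \<comment> \<open>The part of the vertex vector orthogonal to \<open>\<phi>\<close> is an empty
      mode.\<close>
    have "axis i 1 - \<phi> $ i *\<^sub>R \<phi> \<in> V"
      by (rule V_all) (simp add: inner_diff_left inner_axis' \<phi>\<phi>)
    then show ?thesis
      by (simp add: V_def ann.diff ann.scale smeared_annihilation_axis)
  qed
  \<comment> \<open>Particles are counted twice: \<open>X\<close> has \<open>N + 1\<close> of them,
    yet all sit in \<open>\<phi>\<close>, whose occupation number in \<open>X\<close> is one. Hence
    \<open>N\<close> times \<open>X\<close> vanishes.\<close>
  have "real (Suc N) *\<^sub>R X = (\<Sum>i\<in>UNIV. creation i *v (annihilation i *v X))"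
    using sum_number_op[OF X] by (simp add: number_op_mult)
  also have "\<dots> = smeared_creation \<phi> (smeared_annihilation \<phi> X)"
    by (simp add: occ fock_linear_simps smeared_creation_def)
  also have "\<dots> = X"
    using smeared_annihilation_creation[of \<phi> \<phi> X]
    by (simp add: X_def smeared_creation_nilpotent \<phi>\<phi> smeared_annihilation_def fock_linear_simps)
  finally have "real N *\<^sub>R X = 0" by (simp add: scaleR_add_left)
  then show ?thesis using N by (simp add: X_def)
qed

subsection \<open>Ground-state densities\<close>

lemma mem_eigenspace_on: "v \<in> eigenspace_on V A E \<longleftrightarrow> v \<in> V \<and> A *v v = E *\<^sub>R v"
proof -
  have "complex_of_real E *s v = E *\<^sub>R v"
    by (simp add: vec_eq_iff) (simp add: scaleR_conv_of_real)
  then show ?thesis by (simp add: eigenspace_on_def)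
qed

lemma ground_energy_on_le:
  assumes "ground_energy_on V A E" "v \<in> V" "v \<noteq> 0" "A *v v = E' *\<^sub>R v"
  shows "E \<le> E'"
  using assms unfolding ground_energy_on_def eigenvalue_on_def Bex_def mem_eigenspace_on by blast

lemma complexify_eigenvector_parts:
  assumes "complexify h *v v = E *\<^sub>R v"
  shows "h *v (\<chi> i. Re (v $ i)) = E *\<^sub>R (\<chi> i. Re (v $ i))"
    and "h *v (\<chi> i. Im (v $ i)) = E *\<^sub>R (\<chi> i. Im (v $ i))"
proof -
  have "(\<Sum>j\<in>UNIV. complex_of_real (h $ i $ j) * v $ j) = E *\<^sub>R v $ i" for i
    using arg_cong[OF assms, of "\<lambda>x. x $ i"] by (simp add: matrix_vector_mult_def map_matrix_def)
  from arg_cong[OF this, of Re] arg_cong[OF this, of Im]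
  show "h *v (\<chi> i. Re (v $ i)) = E *\<^sub>R (\<chi> i. Re (v $ i))"
    and "h *v (\<chi> i. Im (v $ i)) = E *\<^sub>R (\<chi> i. Im (v $ i))"
    by (simp_all add: vec_eq_iff matrix_vector_mult_def)
qed

text \<open>A real matrix acts separately on real and imaginary parts. A nonzero part gives the
  energy bound, and the two real multiples of \<open>\<phi>\<close> combine into one complex
  coefficient.\<close>

lemma lowest_eigenspace_complexify:
  fixes h :: "real^'m^'m"
  assumes \<phi>: "norm \<phi> = 1" "h *v \<phi> = e *\<^sub>R \<phi>"
    and ge: "\<And>x. e * (x \<bullet> x) \<le> x \<bullet> (h *v x)"
    and simple: "\<And>u. h *v u = e *\<^sub>R u \<Longrightarrow> \<exists>c. u = c *\<^sub>R \<phi>"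
  defines "\<psi> \<equiv> \<chi> i. complex_of_real (\<phi> $ i)"
  shows "norm \<psi> = 1" "ground_energy_on UNIV (complexify h) e"
    "eigenspace_on UNIV (complexify h) e = vec.span {\<psi>}"
proof -
  show norm: "norm \<psi> = 1" using \<phi>(1) by (simp add: \<psi>_def norm_vec_def)
  have "(\<Sum>j\<in>UNIV. complex_of_real (h $ i $ j) * complex_of_real (\<phi> $ j)) = e *\<^sub>R complex_of_real (\<phi> $ i)" for i
  proof -
    have "(h *v \<phi>) $ i = e * \<phi> $ i" by (simp add: \<phi>)
    then show ?thesis
      by (simp add: matrix_vector_mult_def scaleR_conv_of_real flip: of_real_mult of_real_sum)
  qed
  then have \<psi>: "\<psi> \<in> eigenspace_on UNIV (complexify h) e"
    by (simp add: mem_eigenspace_on vec_eq_iff \<psi>_def matrix_vector_mult_def map_matrix_def)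
  have least: "e \<le> E" if u: "h *v u = E *\<^sub>R u" "u \<noteq> 0" for E u
    using ge[of u] u by simp
  show "ground_energy_on UNIV (complexify h) e"
    unfolding ground_energy_on_def eigenvalue_on_def
  proof (intro conjI allI impI)
    show "\<exists>v\<in>eigenspace_on UNIV (complexify h) e. v \<noteq> 0" using \<psi> norm by (intro bexI[of _ \<psi>]) auto
    fix E
    assume "\<exists>v\<in>eigenspace_on UNIV (complexify h) E. v \<noteq> 0"
    then obtain v where v: "complexify h *v v = E *\<^sub>R v" "v \<noteq> 0" by (auto simp: mem_eigenspace_on)
    then have "(\<chi> i. Re (v $ i)) \<noteq> 0 \<or> (\<chi> i. Im (v $ i)) \<noteq> 0"
      by (auto simp: vec_eq_iff complex_eq_iff)
    then show "e \<le> E" using complexify_eigenvector_parts[OF v(1)] least by blast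
  qed
  show "eigenspace_on UNIV (complexify h) e = vec.span {\<psi>}"
  proof
    show "vec.span {\<psi>} \<subseteq> eigenspace_on UNIV (complexify h) e"
    proof -
      have "complexify h *v (c *s \<psi>) = c *s (complexify h *v \<psi>)" for c
        by (rule vec.linear_scale[OF matrix_vector_mul_linear_gen])
      then show ?thesis
        using \<psi> by (auto simp: vec.span_singleton eigenspace_on_def mult.commute)
    qed
    show "eigenspace_on UNIV (complexify h) e \<subseteq> vec.span {\<psi>}"
    proof
      fix v assume "v \<in> eigenspace_on UNIV (complexify h) e"
      then have "complexify h *v v = e *\<^sub>R v" by (simp add: mem_eigenspace_on)
      from complexify_eigenvector_parts[OF this] simple
      obtain a b where "(\<chi> i. Re (v $ i)) = a *\<^sub>R \<phi>" "(\<chi> i. Im (v $ i)) = b *\<^sub>R \<phi>" by metis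
      then have "v = Complex a b *s \<psi>"
        by (simp add: vec_eq_iff complex_eq_iff \<psi>_def)
      then show "v \<in> vec.span {\<psi>}" by (auto simp: vec.span_singleton)
    qed
  qed
qed

text \<open>\<open>ground_energy_on\<close> speaks of eigenvalues only; the variational bound
  follows because the minimum of the Rayleigh quotient on the sector is itself an
  eigenvalue.\<close>

lemma ground_energy_sector_least:
  assumes "transpose h = h" and E: "ground_energy_on (sector N) (hamiltonian (complexify h)) E"
    and x: "x \<in> sector N"
  shows "E * (x \<bullet> x) \<le> x \<bullet> (hamiltonian (complexify h) *v x)"
proof (cases "x = 0")
  case False
  let ?H = "hamiltonian (complexify h)"
  obtain v e where v: "v \<in> sector N" "norm v = 1" "?H *v v = e *\<^sub>R v"
    and ge: "\<And>x. x \<in> sector N \<Longrightarrow> e * (x \<bullet> x) \<le> x \<bullet> (?H *v x)"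
    by (rule selfadjoint_least_eigenvalue[of "(*v) ?H" "sector N" x])
      (use x False in \<open>auto simp: real_linear_mult inner_hamiltonian[OF assms(1)] subspace_sector
          hamiltonian_sector\<close>)
  have "v \<noteq> 0" using v(2) by auto
  then have "E \<le> e" by (rule ground_energy_on_le[OF E v(1) _ v(3)])
  then have "E * (x \<bullet> x) \<le> e * (x \<bullet> x)" by (intro mult_right_mono) auto
  with ge[OF x] show ?thesis by linarith
qed simp

lemma annihilation_ground_state_nonzero:
  fixes h :: "real^('m::{finite,linorder})^('m::{finite,linorder})"
  assumes sym: "transpose h = h" and con: "graph_connected (complexify h)"
    and neg: "\<And>i j. i \<noteq> j \<Longrightarrow> h $ i $ j \<le> 0"
    and N: "1 \<le> N" and E: "ground_energy_on (sector N) (hamiltonian (complexify h)) E"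
    and \<Psi>: "\<Psi> \<in> sector N" "hamiltonian (complexify h) *v \<Psi> = E *\<^sub>R \<Psi>" "\<Psi> \<noteq> 0"
  shows "annihilation i *v \<Psi> \<noteq> 0"
proof
  assume zero: "annihilation i *v \<Psi> = 0"
  obtain \<phi> e where \<phi>: "norm \<phi> = 1" "h *v \<phi> = e *\<^sub>R \<phi>" and pos: "\<And>i. 0 < \<phi> $ i"
    and ge: "\<And>x. e * (x \<bullet> x) \<le> x \<bullet> (h *v x)"
    and simple: "\<And>u. h *v u = e *\<^sub>R u \<Longrightarrow> \<exists>c. u = c *\<^sub>R \<phi>"
    using lowest_eigenspace[of h, OF sym con neg] by blast
  have "smeared_creation \<phi> \<Psi> = 0"
  proof (rule ground_state_occupies_lowest_mode[OF sym \<phi> ge simple N \<Psi>(1,2)])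
    fix E' X
    assume "X \<in> sector N" "X \<noteq> 0" "hamiltonian (complexify h) *v X = E' *\<^sub>R X"
    then show "E \<le> E'" by (rule ground_energy_on_le[OF E])
  qed
  \<comment> \<open>Both terms of the anticommutator of \<open>annihilation i\<close> and
    \<open>smeared_creation \<phi>\<close> vanish on \<open>\<Psi>\<close>.\<close>
  then have "\<phi> $ i *\<^sub>R \<Psi> = 0"
    using annihilation_smeared_creation[of i \<phi> \<Psi>] by (simp add: zero smeared_creation_scale)
  then show False using pos[of i] \<Psi>(3) by simp
qed

lemma trace_rank_one_sum:
  fixes \<Gamma> B :: "complex^'n^'n"
  assumes "\<And>i j. \<Gamma> $ i $ j = (\<Sum>k\<in>K. v k $ i * cnj (v k $ j))"
  shows "trace (\<Gamma> ** B) = (\<Sum>k\<in>K. cinner (v k) (B *v v k))"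
proof -
  have "trace (\<Gamma> ** B) = (\<Sum>i\<in>UNIV. \<Sum>j\<in>UNIV. \<Sum>k\<in>K. cnj (v k $ j) * B $ j $ i * v k $ i)"
    by (simp add: trace_def matrix_matrix_mult_def assms sum_distrib_right sum_distrib_left
        mult_ac)
  also have "\<dots> = (\<Sum>i\<in>UNIV. \<Sum>k\<in>K. \<Sum>j\<in>UNIV. cnj (v k $ j) * B $ j $ i * v k $ i)"
    by (intro sum.cong refl sum.swap)
  also have "\<dots> = (\<Sum>k\<in>K. \<Sum>i\<in>UNIV. \<Sum>j\<in>UNIV. cnj (v k $ j) * B $ j $ i * v k $ i)"
    by (rule sum.swap)
  also have "\<dots> = (\<Sum>k\<in>K. \<Sum>j\<in>UNIV. \<Sum>i\<in>UNIV. cnj (v k $ j) * B $ j $ i * v k $ i)"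
    by (intro sum.cong refl sum.swap)
  finally show ?thesis
    by (simp add: cinner_def matrix_vector_mult_def sum_distrib_left mult_ac)
qed

text \<open>The vectors \<open>v k\<close> are unnormalised and need not be orthogonal. Zero
  diagonal entries of \<open>\<Gamma>\<close> confine them to the sector, and the minimal total
  energy leaves no excess for any of them.\<close>

lemma ensemble_ground_state_decomposition:
  fixes h :: "real^('m::{finite,linorder})^('m::{finite,linorder})"
  assumes sym: "transpose h = h" and \<Gamma>: "density_matrix N \<Gamma>"
    and E: "ground_energy_on (sector N) (hamiltonian (complexify h)) E"
    and tr: "trace (\<Gamma> ** hamiltonian (complexify h)) = complex_of_real E"
  obtains v and n :: nat where
    "\<forall>B. trace (\<Gamma> ** B) = (\<Sum>k<n. cinner (v k) (B *v v k))"
    "\<forall>k<n. v k \<in> sector N"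
    "\<forall>k<n. hamiltonian (complexify h) *v v k = E *\<^sub>R v k"
    "\<exists>k<n. v k \<noteq> 0"
proof -
  let ?H = "hamiltonian (complexify h)"
  obtain n :: nat and v where dec: "\<And>I J. \<Gamma> $ I $ J = (\<Sum>k<n. v k $ I * cnj (v k $ J))"
    using psd_rank_one_decomposition[of \<Gamma>] \<Gamma> unfolding density_matrix_def by blast
  note trace = trace_rank_one_sum[OF dec]
  have sec: "v k \<in> sector N" if "k < n" for k
    unfolding sector_def
  proof (intro CollectI allI impI)
    fix I :: "'m set" assume "card I \<noteq> N"
    then have "(\<Sum>k<n. v k $ I * cnj (v k $ I)) = 0"
      using \<Gamma> unfolding density_matrix_def dec[symmetric] by blast
    then have "complex_of_real (\<Sum>k<n. (cmod (v k $ I))\<^sup>2) = 0"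
      by (simp flip: complex_norm_square)
    then have "(\<Sum>k<n. (cmod (v k $ I))\<^sup>2) = 0" by (simp only: of_real_eq_0_iff)
    then show "v k $ I = 0" using that by (simp add: sum_nonneg_eq_0_iff)
  qed
  \<comment> \<open>This is \<open>trace \<Gamma> = 1\<close>, read through the decomposition with
    the identity as observable.\<close>
  have one: "(\<Sum>k<n. v k \<bullet> v k) = 1"
    using arg_cong[OF trace[of "mat 1"], of Re] \<Gamma> by (simp add: density_matrix_def Re_cinner)
  have "(\<Sum>k<n. v k \<bullet> (?H *v v k)) = E"
    using arg_cong[OF trace[of ?H], of Re] tr by (simp add: Re_cinner)
  with one have "(\<Sum>k<n. v k \<bullet> (?H *v v k) - E * (v k \<bullet> v k)) = 0"
    by (simp add: sum_subtractf flip: sum_distrib_left)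
  moreover note ge = ground_energy_sector_least[OF sym E]
  ultimately have "v k \<bullet> (?H *v v k) - E * (v k \<bullet> v k) = 0" if "k < n" for k
    by (subst (asm) sum_nonneg_eq_0_iff) (use that sec in auto)
  then have "?H *v v k = E *\<^sub>R v k" if "k < n" for k
    by (intro rayleigh_minimiser_eigenvector[of "(*v) ?H" "sector N"])
      (use that sec ge in \<open>auto simp: real_linear_mult inner_hamiltonian[OF sym] subspace_sector
          hamiltonian_sector\<close>)
  moreover have "\<exists>k<n. v k \<noteq> 0"
  proof (rule ccontr)
    assume "\<not> (\<exists>k<n. v k \<noteq> 0)"
    then show False using one by simp
  qed
  ultimately show ?thesis using that[of v n] trace sec by simp
qed

theorem corollary15:
  fixes h :: "real^('m::{finite,linorder})^('m::{finite,linorder})"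
  assumes "transpose h = h"
    and "graph_connected (complexify h)"
    and "\<And>i j. i \<noteq> j \<Longrightarrow> h $ i $ j \<le> 0"
  shows "(\<exists>E. ground_energy_on UNIV (complexify h) E
        \<and> vec.dim (eigenspace_on UNIV (complexify h) E) = 1)
    \<and> (\<exists>\<phi>. ground_state_on UNIV (complexify h) \<phi>
        \<and> (\<forall>i. \<phi> $ i \<in> \<real> \<and> 0 < Re (\<phi> $ i)))
    \<and> (\<forall>N \<rho>. 1 \<le> N \<and> N \<le> CARD('m)
          \<and> (pure_ground_state_density (complexify h) N \<rho>
            \<or> ensemble_ground_state_density (complexify h) N \<rho>)
        \<longrightarrow> (\<forall>i. 0 < \<rho> $ i))"
proof -
  obtain \<phi> e where \<phi>: "norm \<phi> = 1" "h *v \<phi> = e *\<^sub>R \<phi>" and pos: "\<And>i. 0 < \<phi> $ i"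
    and ge: "\<And>x. e * (x \<bullet> x) \<le> x \<bullet> (h *v x)"
    and simple: "\<And>u. h *v u = e *\<^sub>R u \<Longrightarrow> \<exists>c. u = c *\<^sub>R \<phi>"
    using lowest_eigenspace[of h, OF assms] by blast
  define \<psi> where "\<psi> = (\<chi> i. complex_of_real (\<phi> $ i))"
  have \<psi>: "norm \<psi> = 1" and ground: "ground_energy_on UNIV (complexify h) e"
    and span: "eigenspace_on UNIV (complexify h) e = vec.span {\<psi>}"
    unfolding \<psi>_def using lowest_eigenspace_complexify[OF \<phi> ge simple] by auto
  have "\<psi> \<noteq> 0" using \<psi> by auto
  then have "vec.dim (eigenspace_on UNIV (complexify h) e) = 1"
    unfolding span by (simp add: vec.dim_span_eq_card_independent vec.dependent_single)
  moreover have "ground_state_on UNIV (complexify h) \<psi>"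
    unfolding ground_state_on_def using ground \<psi> span vec.span_base[of \<psi> "{\<psi>}"] by auto
  moreover have "\<psi> $ i \<in> \<real> \<and> 0 < Re (\<psi> $ i)" for i
    using pos by (simp add: \<psi>_def)
  moreover have "0 < \<rho> $ i" if N: "1 \<le> N" and \<rho>: "pure_ground_state_density (complexify h) N \<rho>
      \<or> ensemble_ground_state_density (complexify h) N \<rho>" for N \<rho> i
    using \<rho>
  proof
    assume "pure_ground_state_density (complexify h) N \<rho>"
    then obtain \<Psi> E where E: "ground_energy_on (sector N) (hamiltonian (complexify h)) E"
      and \<Psi>: "\<Psi> \<in> sector N" "hamiltonian (complexify h) *v \<Psi> = E *\<^sub>R \<Psi>" "norm \<Psi> = 1"
      and dens: "complex_of_real (\<rho> $ i) = cinner \<Psi> (number_op i *v \<Psi>)"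
      unfolding pure_ground_state_density_def ground_state_on_def mem_eigenspace_on by blast
    have "\<rho> $ i = (norm (annihilation i *v \<Psi>))\<^sup>2"
      using arg_cong[OF dens, of Re] by (simp add: Re_cinner_number_op)
    moreover have "\<Psi> \<noteq> 0" using \<Psi>(3) by auto
    ultimately show ?thesis
      using annihilation_ground_state_nonzero[OF assms N E \<Psi>(1,2)] by simp
  next
    assume "ensemble_ground_state_density (complexify h) N \<rho>"
    then obtain \<Gamma> E where E: "ground_energy_on (sector N) (hamiltonian (complexify h)) E"
      and \<Gamma>: "density_matrix N \<Gamma>" "trace (\<Gamma> ** hamiltonian (complexify h)) = complex_of_real E"
      and dens: "complex_of_real (\<rho> $ i) = trace (\<Gamma> ** number_op i)"
      unfolding ensemble_ground_state_density_def by blast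
    obtain v and n :: nat where trace: "\<forall>B. trace (\<Gamma> ** B) = (\<Sum>k<n. cinner (v k) (B *v v k))"
      and v: "\<forall>k<n. v k \<in> sector N" "\<forall>k<n. hamiltonian (complexify h) *v v k = E *\<^sub>R v k"
      and nz: "\<exists>k<n. v k \<noteq> 0"
      by (rule ensemble_ground_state_decomposition[OF assms(1) \<Gamma>(1) E \<Gamma>(2)])
    from nz obtain k where k: "k < n" "v k \<noteq> 0" by blast
    then have vk: "v k \<in> sector N" "hamiltonian (complexify h) *v v k = E *\<^sub>R v k"
      using v by simp_all
    have "\<rho> $ i = (\<Sum>k<n. (norm (annihilation i *v v k))\<^sup>2)"
      using arg_cong[OF dens, of Re] by (simp add: trace Re_cinner_number_op)
    \<comment> \<open>All terms are nonnegative, so a single nonzero \<open>v k\<close>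
      suffices.\<close>
    also have "0 < \<dots>"
      using k annihilation_ground_state_nonzero[OF assms N E vk k(2)]
      by (intro sum_pos2[of _ k]; simp)
    finally show ?thesis .
  qed
  ultimately show ?thesis using ground by (intro conjI exI[of _ e] exI[of _ \<psi>]) auto
qed

end
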